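(* Let $V$ be a finite set with $|V|>1$ and let $(\mathsf Z_i:i\in V)$ be a finite linear source with entropy function $H$. Let $\mathcal P^*$ be the fundamental partition. Then: (a) there exists an integral optimal rate vector in $\mathscr R^*_{\mathrm{NCO}}(V)$ (i.e. $\mathscr R^*_{\mathrm{NCO}}(V)\ne\emptyset$, where $\mathscr R^*_{\mathrm{NCO}}(V)=\{\mathbf r_V\in \mathscr R_{\mathrm{CO}}(V)\cap\mathbb Z^{|V|}: r(V)=R_{\mathrm{NCO}}(V)\}$ and $R_{\mathrm{NCO}}(V)=\lceil R_{\mathrm{ACO}}(V)\rceil$); (b) there exists a fractional (rational) optimal rate vector $\mathbf r_V\in\mathscr R^*_{\mathrm{ACO}}(V)$ that can be implemented by $(|\mathcal P^*|-1)$-packet-splitting, i.e. such that $(|\mathcal P^*|-1)\,\mathbf r_V\in\mathbb Z^{|V|}$.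
   Context: Finite linear source: there are a finite field $\mathbb F_q$, a uniformly distributed random vector $\mathsf x\in\mathbb F_q^{l}$ and matrices $A_i$ over $\mathbb F_q$ with $l$ columns such that $\mathsf Z_i=A_i\mathsf x$, $i\in V$. For $X\subseteq V$, $H(X)$ (entropy measured in units of $\log q$) equals the rank of the matrix obtained by stacking the $A_i$, $i\in X$; so $H$ is integer-valued, and it is assumed that $H(V)=l$. $H(\emptyset)=0$, $H(X|Y)=H(X\cup Y)-H(Y)$. For $\mathbf r_V=(r_i:i\in V)\in\mathbb R^{|V|}$, $r(X)=\sum_{i\in X}r_i$. $\mathscr R_{\mathrm{CO}}(V)=\{\mathbf r_V\in\mathbb R^{|V|}: r(X)\ge H(X|V\setminus X)\ \forall X\subsetneq V\}$; $R_{\mathrm{ACO}}(V)=\min\{r(V):\mathbf r_V\in\mathscr R_{\mathrm{CO}}(V)\}$; $R_{\mathrm{NCO}}(V)=\min\{r(V):\mathbf r_V\in\mathscr R_{\mathrm{CO}}(V)\cap\mathbb Z^{|V|}\}$; $\mathscr R^*_{\mathrm{ACO}}(V)=\{\mathbf r_V\in\mathscr R_{\mathrm{CO}}(V): r(V)=R_{\mathrm{ACO}}(V)\}$. $\Pi'(V)$ is the set of partitions $\mathcal P$ of $V$ with $|\mathcal P|>1$. One has $R_{\mathrm{ACO}}(V)=\max_{\mathcal P\in\Pi'(V)}\varphi(\mathcal P)$ with $\varphi(\mathcal P)=\sum_{C\in\mathcal P}\frac{H(V)-H(C)}{|\mathcal P|-1}$; among the maximizers there is a unique finest one, called the fundamental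 partition $\mathcal P^*$. A rate vector $\mathbf r_V$ can be implemented by $k$-packet-splitting ($k$ a positive integer) if $k\mathbf r_V$ is integral (each packet is divided into $k$ chunks). *)

theory Defs
  imports "HOL-Probability.Information" "HOL-Library.Disjoint_Sets" "Jordan_Normal_Form.Matrix"
begin

subsection \<open>Finite linear sources\<close>

text \<open>
  The Shannon entropy of the joint variable \<open>(Z i : i \<in> X)\<close>. The logarithm has base
  \<open>q\<close>, the size of the field, so entropy is measured in units of \<open>log q\<close>.
\<close>

definition source_entropy ::
    "'w measure \<Rightarrow> ('v \<Rightarrow> 'w \<Rightarrow> 'f::{field,finite} vec) \<Rightarrow> 'v set \<Rightarrow> real" where
  "source_entropy M Z X =
     prob_space.entropy M (real CARD('f))
       (count_space ((\<lambda>\<omega>. \<lambda>i\<in>X. Z i \<omega>) ` space M)) (\<lambda>\<omega>. \<lambda>i\<in>X. Z i \<omega>)"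

definition finite_linear_source ::
    "'w measure \<Rightarrow> 'v set \<Rightarrow> ('v \<Rightarrow> 'w \<Rightarrow> 'f::{field,finite} vec) \<Rightarrow> bool" where
  "finite_linear_source M V Z \<longleftrightarrow>
     prob_space M \<and>
     (\<exists>l x A.
        x \<in> M \<rightarrow>\<^sub>M count_space (carrier_vec l) \<and>
        distr M (count_space (carrier_vec l)) x = uniform_count_measure (carrier_vec l) \<and>
        (\<forall>i\<in>V. dim_col (A i) = l \<and> (\<forall>\<omega>\<in>space M. Z i \<omega> = A i *\<^sub>v x \<omega>)) \<and>
        source_entropy M Z V = real l)"

subsection \<open>Communication for omniscience\<close>

text \<open>
  \<open>H\<close> is an arbitrary real set function here. A rate vector in \<open>\<real>\<^sup>V\<close> is a
  function on \<open>V\<close>, extended by \<open>undefined\<close> outside \<open>V\<close>.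
\<close>

definition cond_entropy :: "('v set \<Rightarrow> real) \<Rightarrow> 'v set \<Rightarrow> 'v set \<Rightarrow> real" where
  "cond_entropy H X Y = H (X \<union> Y) - H Y"

definition R_CO :: "('v set \<Rightarrow> real) \<Rightarrow> 'v set \<Rightarrow> ('v \<Rightarrow> real) set" where
  "R_CO H V = {r \<in> V \<rightarrow>\<^sub>E UNIV. \<forall>X. X \<subset> V \<longrightarrow> sum r X \<ge> cond_entropy H X (V - X)}"

definition rate_ACO :: "('v set \<Rightarrow> real) \<Rightarrow> 'v set \<Rightarrow> real" where
  "rate_ACO H V = (LEAST t. t \<in> (\<lambda>r. sum r V) ` R_CO H V)"

definition rate_NCO :: "('v set \<Rightarrow> real) \<Rightarrow> 'v set \<Rightarrow> real" where
  "rate_NCO H V = (LEAST t. t \<in> (\<lambda>r. sum r V) ` (R_CO H V \<inter> (V \<rightarrow>\<^sub>E \<int>)))"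

definition R_ACO_opt :: "('v set \<Rightarrow> real) \<Rightarrow> 'v set \<Rightarrow> ('v \<Rightarrow> real) set" where
  "R_ACO_opt H V = {r \<in> R_CO H V. sum r V = rate_ACO H V}"

definition R_NCO_opt :: "('v set \<Rightarrow> real) \<Rightarrow> 'v set \<Rightarrow> ('v \<Rightarrow> real) set" where
  "R_NCO_opt H V = {r \<in> R_CO H V \<inter> (V \<rightarrow>\<^sub>E \<int>). sum r V = rate_NCO H V}"

subsection \<open>The fundamental partition\<close>

definition nontrivial_partitions :: "'v set \<Rightarrow> 'v set set set" where
  "nontrivial_partitions V = {P. partition_on V P \<and> card P > 1}"

definition partition_value :: "('v set \<Rightarrow> real) \<Rightarrow> 'v set \<Rightarrow> 'v set set \<Rightarrow> real" where
  "partition_value H V P = (\<Sum>C\<in>P. (H V - H C) / (real (card P) - 1))"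

definition max_partitions :: "('v set \<Rightarrow> real) \<Rightarrow> 'v set \<Rightarrow> 'v set set set" where
  "max_partitions H V =
     {P \<in> nontrivial_partitions V.
        \<forall>Q\<in>nontrivial_partitions V. partition_value H V Q \<le> partition_value H V P}"

definition fundamental_partition :: "('v set \<Rightarrow> real) \<Rightarrow> 'v set \<Rightarrow> 'v set set" where
  "fundamental_partition H V =
     (THE P. P \<in> max_partitions H V \<and> (\<forall>Q\<in>max_partitions H V. refines V P Q))"

subsection \<open>Packet splitting\<close>

definition implementable_by_packet_splitting :: "nat \<Rightarrow> 'v set \<Rightarrow> ('v \<Rightarrow> real) \<Rightarrow> bool" where
  "implementable_by_packet_splitting k V r \<longleftrightarrow> k > 0 \<and> (\<forall>i\<in>V. real k * r i \<in> \<int>)"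

end

theory Submission
  imports Defs
begin

text \<open>
  A rate vector of sum rate \<open>t\<close> lies in \<open>R_CO H V\<close> iff \<open>sum r Y \<le> f Y\<close> for all nonempty
  \<open>Y \<subseteq> V\<close>, where \<open>f Y = H Y - H V + t\<close> and \<open>f V = t\<close>. For a linear source \<open>H\<close> is integral and
  submodular, so \<open>k f\<close> is submodular and integral as soon as \<open>k t\<close> is an integer. An integral
  submodular function \<open>g\<close> with \<open>g V \<le> sum g P\<close> for all partitions \<open>P\<close> admits an integral \<open>s \<le> g\<close> with
  \<open>sum s V = g V\<close>; for \<open>g = k f\<close> the partition condition reads \<open>t \<ge> partition_value H V P\<close>.
  Hence the optimal rate is the maximal partition value. It becomes integral after scaling by
  \<open>card P - 1\<close> for every maximising \<open>P\<close>, and rounding it up allows \<open>k = 1\<close>.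
\<close>

subsection \<open>Integral vectors below a submodular function\<close>

text \<open>The usual uncrossing: modularity of \<open>sum r\<close> gives \<open>f A + f B\<close>
  on the left, submodularity bounds \<open>f (A \<union> B) + f (A \<inter> B)\<close> by the same
  number, so neither of the two upper bounds can be strict. Overlap of \<open>A\<close> and
  \<open>B\<close> makes the bound on \<open>A \<inter> B\<close> available.\<close>

lemma tight_Un_Int:
  fixes r f :: "_ \<Rightarrow> 'b::linordered_ab_group_add"
  assumes "finite V" "A \<subseteq> V" "B \<subseteq> V" "A \<inter> B \<noteq> {}"
    and sub: "f (A \<union> B) + f (A \<inter> B) \<le> f A + f B"
    and le: "\<And>Y. Y \<subseteq> V \<Longrightarrow> Y \<noteq> {} \<Longrightarrow> sum r Y \<le> f Y"
    and tight: "sum r A = f A" "sum r B = f B"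
  shows "sum r (A \<union> B) = f (A \<union> B)" "sum r (A \<inter> B) = f (A \<inter> B)"
proof -
  have "finite A" "finite B" using finite_subset[OF assms(2,1)] finite_subset[OF assms(3,1)] .
  then have 1: "sum r (A \<union> B) + sum r (A \<inter> B) = f A + f B"
    using sum.union_inter[of A B r] by (simp add: tight)
  have 2: "sum r (A \<union> B) \<le> f (A \<union> B)" "sum r (A \<inter> B) \<le> f (A \<inter> B)"
    using assms by (auto intro!: le)
  show "sum r (A \<union> B) = f (A \<union> B)" "sum r (A \<inter> B) = f (A \<inter> B)"
    using add_less_le_mono[of "sum r (A \<union> B)" "f (A \<union> B)" "sum r (A \<inter> B)" "f (A \<inter> B)"]
      add_le_less_mono[of "sum r (A \<union> B)" "f (A \<union> B)" "sum r (A \<inter> B)" "f (A \<inter> B)"] 1 2 sub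
    by (force simp: not_less[symmetric] order.order_iff_strict)+
qed

lemma sum_partition_on:
  assumes "finite V" "partition_on V P"
  shows "sum r V = (\<Sum>C\<in>P. sum r C)"
proof -
  have "\<forall>C\<in>P. finite C"
    using finite_subset[OF _ assms(1)] partition_onD1[OF assms(2)] by blast
  then have "sum r (\<Union>P) = (\<Sum>C\<in>P. sum r C)"
    using assms(2) by (subst sum.Union_disjoint) (auto simp: partition_on_def disjoint_def)
  then show ?thesis
    using assms(2) by (simp add: partition_on_def)
qed

text \<open>An integral form of Edmonds' theorem on Dilworth truncation: the partition condition
  says that truncation does not lower the value at \<open>V\<close>. Nothing is demanded of
  \<open>f {}\<close>, which is in general not 0 in the application; hence submodularity is stated
  for intersecting pairs.\<close>

lemma integral_base_vector:
  fixes f :: "'a set \<Rightarrow> int"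
  assumes fin: "finite V" and "V \<noteq> {}"
    and sub: "\<And>A B. A \<subseteq> V \<Longrightarrow> B \<subseteq> V \<Longrightarrow> A \<inter> B \<noteq> {} \<Longrightarrow> f (A \<union> B) + f (A \<inter> B) \<le> f A + f B"
    and part: "\<And>P. partition_on V P \<Longrightarrow> f V \<le> sum f P"
  obtains r :: "'a \<Rightarrow> int"
  where "\<And>Y. Y \<subseteq> V \<Longrightarrow> Y \<noteq> {} \<Longrightarrow> sum r Y \<le> f Y" and "sum r V = f V"
proof -
  define feasible where "feasible r \<longleftrightarrow> (\<forall>Y. Y \<subseteq> V \<longrightarrow> Y \<noteq> {} \<longrightarrow> sum r Y \<le> f Y)" for r :: "'a \<Rightarrow> int"
  \<comment> \<open>A uniform bound on \<open>f\<close>. The constant vector \<open>-N\<close> is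
    feasible because a nonempty set contributes at least one summand.\<close>
  define N where "N = Max ((\<lambda>Y. \<bar>f Y\<bar>) ` Pow V)"
  have N: "\<bar>f Y\<bar> \<le> N" if "Y \<subseteq> V" for Y
    unfolding N_def using that fin by (intro Max_ge) auto
  have "feasible (\<lambda>_. - N)"
    unfolding feasible_def
  proof (intro allI impI)
    fix Y assume Y: "Y \<subseteq> V" "Y \<noteq> {}"
    have "N \<ge> 0" using N[OF Y(1)] by linarith
    moreover have "card Y \<ge> 1"
      using Y fin by (simp add: Suc_leI card_gt_0_iff finite_subset)
    ultimately have "1 * N \<le> int (card Y) * N"
      by (intro mult_right_mono) auto
    then show "(\<Sum>_\<in>Y. - N) \<le> f Y"
      using N[OF Y(1)] by simp
  qed
  \<comment> \<open>For an integral vector of maximal total, every point lies in a tight set, since otherwise its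
    coordinate could grow by 1; the largest tight sets around the points then partition \<open>V\<close>.\<close>
  then obtain r where r: "feasible r"
    and least: "\<And>r'. feasible r' \<Longrightarrow> nat (f V - sum r V) \<le> nat (f V - sum r' V)"
    using ex_has_least_nat[of feasible _ "\<lambda>r. nat (f V - sum r V)"] by blast
  have le: "sum r Y \<le> f Y" if "Y \<subseteq> V" "Y \<noteq> {}" for Y
    using r that by (auto simp: feasible_def)
  define tight where "tight Y \<longleftrightarrow> Y \<subseteq> V \<and> Y \<noteq> {} \<and> sum r Y = f Y" for Y
  have tight_Un: "tight (A \<union> B)" if "tight A" "tight B" "A \<inter> B \<noteq> {}" for A B
    using that tight_Un_Int(1)[of V A B f r] fin sub[of A B] le by (auto simp: tight_def)
  have ex_tight: "\<exists>T. tight T \<and> i \<in> T" if i: "i \<in> V" for i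
  proof (rule ccontr)
    assume no: "\<not> ?thesis"
    have *: "sum (r(i := r i + 1)) Y = sum r Y + (if i \<in> Y then 1 else 0)" if "Y \<subseteq> V" for Y
    proof -
      have "finite Y" using that fin finite_subset by auto
      have "sum (r(i := r i + 1)) Y = (\<Sum>j\<in>Y. r j + (if j = i then 1 else 0))"
        by (intro sum.cong) auto
      then show ?thesis using \<open>finite Y\<close> by (simp add: sum.distrib)
    qed
    have "feasible (r(i := r i + 1))"
      unfolding feasible_def
    proof (intro allI impI)
      fix Y assume Y: "Y \<subseteq> V" "Y \<noteq> {}"
      \<comment> \<open>Integrality enters here: a set that is not tight has slack at least
        1.\<close>
      have "i \<in> Y \<Longrightarrow> sum r Y \<noteq> f Y" using no Y by (auto simp: tight_def)
      then show "sum (r(i := r i + 1)) Y \<le> f Y"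
        using le[OF Y] *[OF Y(1)] by auto
    qed
    \<comment> \<open>Feasibility keeps both totals at most \<open>f V\<close>, so
      \<open>nat\<close> truncates nothing and the increment strictly lowers the minimised
      gap.\<close>
    from least[OF this] *[of V] i le[of V] this show False
      by (auto simp: feasible_def)
  qed
  have "\<exists>T. (tight T \<and> i \<in> T) \<and> (\<forall>T'. tight T' \<and> i \<in> T' \<longrightarrow> card T' \<le> card T)" if "i \<in> V" for i
  proof -
    obtain T where "tight T \<and> i \<in> T" using ex_tight \<open>i \<in> V\<close> by blast
    then show ?thesis
      by (rule ex_has_greatest_nat[where b = "card V + 1"])
        (use fin in \<open>auto simp: tight_def less_Suc_eq_le intro!: card_mono\<close>)
  qed
  then obtain C where C: "\<And>i. i \<in> V \<Longrightarrow> tight (C i) \<and> i \<in> C i"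
    and C_max: "\<And>i T. i \<in> V \<Longrightarrow> tight T \<Longrightarrow> i \<in> T \<Longrightarrow> card T \<le> card (C i)"
    by metis
  \<comment> \<open>\<open>T \<union> C i\<close> is again tight and contains \<open>i\<close>, so
    it cannot be larger than \<open>C i\<close>.\<close>
  have C_absorb: "T \<subseteq> C i" if "i \<in> V" "tight T" "T \<inter> C i \<noteq> {}" for i T
  proof -
    have t: "tight (T \<union> C i)" using tight_Un C that by auto
    then have "card (T \<union> C i) \<le> card (C i)" using C_max C that by auto
    moreover have "finite (T \<union> C i)" using t fin finite_subset unfolding tight_def by blast
    ultimately have "C i = T \<union> C i" by (intro card_seteq) auto
    then show ?thesis by auto
  qed
  have P: "partition_on V (C ` V)"
  proof (rule partition_onI)
    show "\<Union> (C ` V) = V" using C by (auto simp: tight_def)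
    show "disjnt p q" if pq: "p \<in> C ` V" "q \<in> C ` V" "p \<noteq> q" for p q
    proof (rule ccontr)
      assume "\<not> disjnt p q"
      moreover obtain i where i: "i \<in> V" "p = C i" using pq(1) by blast
      moreover obtain j where j: "j \<in> V" "q = C j" using pq(2) by blast
      ultimately have "p \<inter> C j \<noteq> {}" "q \<inter> C i \<noteq> {}" by (auto simp: disjnt_def)
      then have "p \<subseteq> q" "q \<subseteq> p" using C_absorb C i j by blast+
      then show False using pq(3) by auto
    qed
    show "{} \<notin> C ` V" using C by auto
  qed
  have "sum r V = (\<Sum>T\<in>C ` V. sum r T)" using sum_partition_on[OF fin P] .
  also have "\<dots> = sum f (C ` V)" using C by (intro sum.cong) (auto simp: tight_def)
  \<comment> \<open>The blocks are tight, so the total of \<open>r\<close> is a partition sum of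
    \<open>f\<close> and is at least \<open>f V\<close>; feasibility gives the other
    inequality.\<close>
  finally have "sum r V = f V" using part[OF P] le[of V] \<open>V \<noteq> {}\<close> by auto
  with le show thesis using that by blast
qed

subsection \<open>Optimal rate vectors for integral submodular functions\<close>

text \<open>The interface between the optimisation and the linear source: the entropy of the source
  is later shown to satisfy these assumptions.\<close>

locale integral_submodular =
  fixes V :: "'v set" and H :: "'v set \<Rightarrow> real"
  assumes finite_V: "finite V" and card_V: "card V > 1"
    and H_Ints: "X \<subseteq> V \<Longrightarrow> H X \<in> \<int>"
    and submodular: "A \<subseteq> V \<Longrightarrow> B \<subseteq> V \<Longrightarrow> H (A \<union> B) + H (A \<inter> B) \<le> H A + H B"
begin

text \<open>Complementation \<open>X = V - Y\<close> turns lower bounds on proper subsets into upper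
  bounds on nonempty subsets. The case \<open>Y = V\<close> is trivially an equality and corresponds
  to \<open>X = {}\<close>.\<close>

lemma R_CO_iff:
  "r \<in> R_CO H V \<longleftrightarrow>
    r \<in> V \<rightarrow>\<^sub>E UNIV \<and> (\<forall>Y. Y \<subseteq> V \<longrightarrow> Y \<noteq> {} \<longrightarrow> sum r Y \<le> H Y - H V + sum r V)"
proof -
  have *: "sum r (V - Y) = sum r V - sum r Y" if "Y \<subseteq> V" for Y
    using that finite_V by (simp add: sum_diff)
  have "(\<forall>X. X \<subset> V \<longrightarrow> sum r X \<ge> H V - H (V - X)) \<longleftrightarrow>
    (\<forall>Y. Y \<subseteq> V \<longrightarrow> Y \<noteq> {} \<longrightarrow> sum r Y \<le> H Y - H V + sum r V)" (is "?L \<longleftrightarrow> ?R")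
  proof (intro iffI allI impI)
    fix Y assume ?L "Y \<subseteq> V" "Y \<noteq> {}"
    then have "sum r (V - Y) \<ge> H V - H (V - (V - Y))" by blast
    then show "sum r Y \<le> H Y - H V + sum r V"
      using \<open>Y \<subseteq> V\<close> *[of Y] by (simp add: double_diff)
  next
    fix X assume ?R "X \<subset> V"
    then have "sum r (V - X) \<le> H (V - X) - H V + sum r V" by blast
    then show "sum r X \<ge> H V - H (V - X)"
      using \<open>X \<subset> V\<close> *[of X] by auto
  qed
  moreover have "X \<union> (V - X) = V" if "X \<subset> V" for X using that by auto
  ultimately show ?thesis
    by (auto simp: R_CO_def cond_entropy_def)
qed

text \<open>With \<open>n = card P - 1\<close> and \<open>s\<close> the sum of the
  \<open>H V - H C\<close>, the partition value is \<open>s / n\<close> and the right-hand sum is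
  \<open>t + (t * n - s)\<close>. Both sides therefore compare \<open>s\<close> with
  \<open>t * n\<close>.\<close>

lemma partition_value_le_iff:
  assumes "P \<in> nontrivial_partitions V"
  shows "partition_value H V P \<le> t \<longleftrightarrow> t \<le> (\<Sum>C\<in>P. H C - H V + t)"
    and "partition_value H V P = t \<longleftrightarrow> t = (\<Sum>C\<in>P. H C - H V + t)"
proof -
  define n where "n = real (card P) - 1"
  have "n > 0" using assms by (auto simp: n_def nontrivial_partitions_def)
  define s where "s = (\<Sum>C\<in>P. H V - H C)"
  have 1: "partition_value H V P = s / n"
    by (simp add: partition_value_def n_def s_def sum_divide_distrib)
  have 2: "(\<Sum>C\<in>P. H C - H V + t) = t + (t * n - s)"
    by (simp add: sum.distrib sum_subtractf n_def s_def algebra_simps)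
  show "partition_value H V P \<le> t \<longleftrightarrow> t \<le> (\<Sum>C\<in>P. H C - H V + t)"
    "partition_value H V P = t \<longleftrightarrow> t = (\<Sum>C\<in>P. H C - H V + t)"
    unfolding 1 2 using \<open>n > 0\<close> by (auto simp: divide_le_eq divide_eq_eq)
qed

text \<open>Weak duality: add the upper bounds of \<open>R_CO_iff\<close> over the blocks of
  \<open>P\<close>.\<close>

lemma partition_value_le_sum:
  assumes r: "r \<in> R_CO H V" and P: "P \<in> nontrivial_partitions V"
  shows "partition_value H V P \<le> sum r V"
proof -
  have part: "partition_on V P" using P by (simp add: nontrivial_partitions_def)
  have "sum r V = (\<Sum>C\<in>P. sum r C)" by (rule sum_partition_on[OF finite_V part])
  also have "\<dots> \<le> (\<Sum>C\<in>P. H C - H V + sum r V)"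
    using r part by (intro sum_mono) (auto simp: R_CO_iff partition_on_def)
  finally show ?thesis using partition_value_le_iff(1)[OF P] by simp
qed

lemma trivial_partition:
  assumes P: "partition_on V P" and "\<not> card P > 1"
  shows "P = {V}"
proof -
  have "V \<noteq> {}" using card_V by auto
  then have "finite P" "P \<noteq> {}" using finite_elements[OF finite_V P] P by (auto simp: partition_on_def)
  with assms(2) have "card P = 1" using card_gt_0_iff[of P] by linarith
  then show ?thesis using P by (auto simp: card_1_singleton_iff partition_on_def)
qed

text \<open>Strong duality with control of denominators: scale the upper bounds by \<open>k\<close>,
  take an integral vector below them, and divide by \<open>k\<close> again.\<close>

lemma ex_rate_vector:
  fixes k :: nat
  assumes "k > 0" and kt: "real k * t \<in> \<int>"
    and t: "\<And>P. P \<in> nontrivial_partitions V \<Longrightarrow> partition_value H V P \<le> t"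
  obtains r where "r \<in> R_CO H V" "sum r V = t" "\<And>i. i \<in> V \<Longrightarrow> real k * r i \<in> \<int>"
proof -
  \<comment> \<open>The floor serves only as a conversion to \<open>int\<close>: on subsets of
    \<open>V\<close> its argument is already an integer.\<close>
  define f where "f Y = \<lfloor>real k * (H Y - H V + t)\<rfloor>" for Y
  have f: "of_int (f Y) = real k * (H Y - H V + t)" if "Y \<subseteq> V" for Y
  proof -
    have "real k * (H Y - H V + t) = real k * H Y - real k * H V + real k * t"
      by (simp add: algebra_simps)
    also have "\<dots> \<in> \<int>" using kt H_Ints that by auto
    finally show ?thesis by (simp add: f_def)
  qed
  have "V \<noteq> {}" using card_V by auto
  have "f V \<le> sum f P" if P: "partition_on V P" for P
  proof (cases "card P > 1")
    case True
    then have P': "P \<in> nontrivial_partitions V" using P by (simp add: nontrivial_partitions_def)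
    have "of_int (f V) = real k * t" by (simp add: f)
    also have "\<dots> \<le> real k * (\<Sum>C\<in>P. H C - H V + t)"
      using t[OF P'] partition_value_le_iff(1)[OF P'] by (intro mult_left_mono) auto
    also have "\<dots> = (\<Sum>C\<in>P. of_int (f C))"
      unfolding sum_distrib_left using P by (intro sum.cong refl f[symmetric]) (auto simp: partition_on_def)
    finally show ?thesis by (simp flip: of_int_sum)
  next
    case False
    then show ?thesis using trivial_partition[OF P] by simp
  qed
  moreover have "f (A \<union> B) + f (A \<inter> B) \<le> f A + f B" if "A \<subseteq> V" "B \<subseteq> V" for A B
  proof -
    have "real k * (H (A \<union> B) + H (A \<inter> B)) \<le> real k * (H A + H B)"
      using submodular[OF that] by (intro mult_left_mono) auto
    moreover have "A \<union> B \<subseteq> V" "A \<inter> B \<subseteq> V" using that by auto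
    ultimately have "real_of_int (f (A \<union> B) + f (A \<inter> B)) \<le> of_int (f A + f B)"
      using that by (simp add: f algebra_simps)
    then show ?thesis by linarith
  qed
  ultimately obtain s where s_le: "\<And>Y. Y \<subseteq> V \<Longrightarrow> Y \<noteq> {} \<Longrightarrow> sum s Y \<le> f Y" and s_eq: "sum s V = f V"
    using integral_base_vector[OF finite_V \<open>V \<noteq> {}\<close>, of f] by metis
  define r where "r = (\<lambda>i\<in>V. real_of_int (s i) / real k)"
  have r: "sum r Y = of_int (sum s Y) / real k" if "Y \<subseteq> V" for Y
    unfolding of_int_sum sum_divide_distrib using that by (intro sum.cong) (auto simp: r_def)
  have r_eq: "sum r V = t" using \<open>k > 0\<close> by (simp add: r s_eq f)
  show thesis
  proof (rule that)
    show "r \<in> R_CO H V"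
      unfolding R_CO_iff
    proof (intro conjI allI impI)
      fix Y assume Y: "Y \<subseteq> V" "Y \<noteq> {}"
      have "of_int (sum s Y) \<le> real_of_int (f Y)" using s_le[OF Y] by (simp only: of_int_le_iff)
      then have "of_int (sum s Y) \<le> real k * (H Y - H V + t)" using f[OF Y(1)] by simp
      then show "sum r Y \<le> H Y - H V + sum r V"
        using Y \<open>k > 0\<close> by (simp add: r r_eq divide_le_eq mult.commute)
    qed (auto simp: r_def)
    show "sum r V = t" by (fact r_eq)
    show "real k * r i \<in> \<int>" if "i \<in> V" for i using that \<open>k > 0\<close> by (simp add: r_def)
  qed
qed

section \<open>Maximising partitions and the optimal rate\<close>

lemma finite_nontrivial_partitions: "finite (nontrivial_partitions V)"
  using finitely_many_partition_on[OF finite_V]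
  by (rule rev_finite_subset) (auto simp: nontrivial_partitions_def)

lemma max_partitions_nonempty: "max_partitions H V \<noteq> {}"
proof -
  have "(\<lambda>x. {x}) ` V \<in> nontrivial_partitions V"
    using card_V by (simp add: nontrivial_partitions_def partition_on_singletons card_image)
  then have "nontrivial_partitions V \<noteq> {}" by auto
  then have "Max (partition_value H V ` nontrivial_partitions V)
      \<in> partition_value H V ` nontrivial_partitions V"
    using finite_nontrivial_partitions by (intro Max_in) auto
  then obtain P where "P \<in> nontrivial_partitions V"
    "partition_value H V P = Max (partition_value H V ` nontrivial_partitions V)" by auto
  then have "P \<in> max_partitions H V"
    using finite_nontrivial_partitions by (auto simp: max_partitions_def)
  then show ?thesis by auto
qed

text \<open>Multiplying the partition value by \<open>card P - 1\<close> clears its only denominator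
  and leaves a sum of integers \<open>H V - H C\<close>. So \<open>ex_rate_vector\<close> applies
  with \<open>k = card P - 1\<close>.\<close>

lemma max_partition_rate_vector:
  assumes "P \<in> max_partitions H V"
  obtains r where "r \<in> R_CO H V" "sum r V = partition_value H V P"
    "\<And>i. i \<in> V \<Longrightarrow> real (card P - 1) * r i \<in> \<int>"
proof -
  have P: "partition_on V P" "card P > 1"
    using assms by (auto simp: max_partitions_def nontrivial_partitions_def)
  have "real (card P - 1) * partition_value H V P = (\<Sum>C\<in>P. H V - H C)"
    using P(2) by (simp add: partition_value_def of_nat_diff flip: sum_divide_distrib)
  also have "\<dots> \<in> \<int>" using H_Ints P(1) by (intro Ints_sum Ints_diff) (auto simp: partition_on_def)
  finally have "real (card P - 1) * partition_value H V P \<in> \<int>" .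
  then show thesis
    using ex_rate_vector[of "card P - 1" "partition_value H V P"] assms P(2) that
    by (auto simp: max_partitions_def)
qed

text \<open>The value is attained by \<open>max_partition_rate_vector\<close> and is a lower bound
  by \<open>partition_value_le_sum\<close>, so the \<open>LEAST\<close> in the definition is a
  genuine minimum.\<close>

lemma rate_ACO_eq:
  assumes "P \<in> max_partitions H V"
  shows "rate_ACO H V = partition_value H V P"
  unfolding rate_ACO_def
proof (rule Least_equality)
  obtain r where "r \<in> R_CO H V" "sum r V = partition_value H V P"
    using max_partition_rate_vector[OF assms] by blast
  then show "partition_value H V P \<in> (\<lambda>r. sum r V) ` R_CO H V" by force
  show "partition_value H V P \<le> t" if "t \<in> (\<lambda>r. sum r V) ` R_CO H V" for t
    using that assms partition_value_le_sum by (auto simp: max_partitions_def)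
qed

text \<open>Complementary slackness: \<open>P\<close> is a maximiser iff the block inequalities for
  \<open>r\<close> add up to an equality, and termwise inequalities with equal finite sums are all
  equalities.\<close>

lemma max_partition_iff_tight:
  assumes r: "r \<in> R_ACO_opt H V" and P: "P \<in> nontrivial_partitions V"
  shows "P \<in> max_partitions H V \<longleftrightarrow> (\<forall>C\<in>P. sum r C = H C - H V + sum r V)"
proof -
  have part: "partition_on V P" using P by (simp add: nontrivial_partitions_def)
  then have "finite P" using finite_V by (rule finite_elements[rotated])
  have rCO: "r \<in> R_CO H V" and r_sum: "sum r V = rate_ACO H V" using r by (auto simp: R_ACO_opt_def)
  obtain Q where Q: "Q \<in> max_partitions H V" using max_partitions_nonempty by auto
  have "P \<in> max_partitions H V \<longleftrightarrow> partition_value H V P = sum r V"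
    using P Q rate_ACO_eq[OF Q] rate_ACO_eq[of P] unfolding r_sum by (auto simp: max_partitions_def)
  also have "\<dots> \<longleftrightarrow> (\<Sum>C\<in>P. sum r C) = (\<Sum>C\<in>P. H C - H V + sum r V)"
    unfolding partition_value_le_iff(2)[OF P] by (simp only: sum_partition_on[OF finite_V part, of r, symmetric])
  also have "\<dots> \<longleftrightarrow> (\<forall>C\<in>P. sum r C = H C - H V + sum r V)"
  proof
    assume eq: "(\<Sum>C\<in>P. sum r C) = (\<Sum>C\<in>P. H C - H V + sum r V)"
    show "\<forall>C\<in>P. sum r C = H C - H V + sum r V"
      using rCO part \<open>finite P\<close>
      by (intro ballI sum_mono_inv[OF eq]) (auto simp: R_CO_iff partition_on_def)
  qed (intro sum.cong, auto)
  finally show ?thesis .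
qed

lemma R_ACO_opt_nonempty: "R_ACO_opt H V \<noteq> {}"
proof -
  obtain P where P: "P \<in> max_partitions H V" using max_partitions_nonempty by auto
  then obtain r where "r \<in> R_CO H V" "sum r V = partition_value H V P"
    using max_partition_rate_vector by blast
  then have "r \<in> R_ACO_opt H V" using rate_ACO_eq[OF P] by (simp add: R_ACO_opt_def)
  then show ?thesis by auto
qed

text \<open>
  The blocks of all maximisers are tight for one and the same optimal rate vector, and
  intersections of overlapping tight sets are tight.
\<close>

lemma common_refinement_max_partition:
  "common_refinement (max_partitions H V) \<in> max_partitions H V" (is "?R \<in> _")
proof -
  obtain r where r: "r \<in> R_ACO_opt H V" using R_ACO_opt_nonempty by blast
  define g where "g Y = H Y - H V + sum r V" for Y
  have r_le: "sum r Y \<le> g Y" if "Y \<subseteq> V" "Y \<noteq> {}" for Y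
    using r that unfolding R_ACO_opt_def R_CO_iff g_def by blast
  have part: "partition_on V P" if "P \<in> max_partitions H V" for P
    using that by (auto simp: max_partitions_def nontrivial_partitions_def)
  have R: "partition_on V ?R"
    by (rule partition_on_common_refinement) (simp_all add: part max_partitions_nonempty)
  \<comment> \<open>If the refinement were \<open>{V}\<close>, a maximiser refined by it would have
    a block containing all of \<open>V\<close> and hence be trivial.\<close>
  have "card ?R > 1"
  proof (rule ccontr)
    assume "\<not> card ?R > 1"
    then have "?R = {V}" by (rule trivial_partition[OF R])
    obtain P where P: "P \<in> max_partitions H V" using max_partitions_nonempty by auto
    have "refines V {V} P"
      using refines_common_refinement[of "max_partitions H V" V P] part P by (simp add: \<open>?R = {V}\<close>)
    then obtain Y where "Y \<in> P" "V \<subseteq> Y" by (auto simp: refines_def)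
    have "Z = Y" if "Z \<in> P" for Z
    proof -
      have "Z \<subseteq> V" using partition_onD1[OF part[OF P]] that by blast
      moreover have "Z \<noteq> {}" using partition_onD3[OF part[OF P]] that by metis
      ultimately have "Z \<inter> Y \<noteq> {}" using \<open>V \<subseteq> Y\<close> by blast
      then show ?thesis using disjointD[OF partition_onD2[OF part[OF P]] that \<open>Y \<in> P\<close>] by blast
    qed
    then have "P = {Y}" using \<open>Y \<in> P\<close> by blast
    then show False using P by (simp add: max_partitions_def nontrivial_partitions_def)
  qed
  with R have nt: "?R \<in> nontrivial_partitions V" by (simp add: nontrivial_partitions_def)
  have "sum r C = g C" if "C \<in> ?R" for C
  proof -
    have "C \<noteq> {}" using R that by (auto simp: partition_on_def)
    \<comment> \<open>A block of the common refinement is the intersection of one block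
      \<open>c P\<close> from each maximiser \<open>P\<close>.\<close>
    obtain c where c: "\<And>P. P \<in> max_partitions H V \<Longrightarrow> c P \<in> P" and C: "C = (\<Inter>P\<in>max_partitions H V. c P)"
      proof -
      obtain c where "c \<in> (\<Pi> P\<in>max_partitions H V. P)" "C = \<Inter> (c ` max_partitions H V)"
        using \<open>C \<in> ?R\<close> unfolding common_refinement by blast
      then show thesis using that[of c] by blast
    qed
    have c_tight: "c P \<subseteq> V \<and> sum r (c P) = g (c P)" if P: "P \<in> max_partitions H V" for P
      using max_partition_iff_tight[OF r, of P] P c[OF P] part[OF P]
      by (auto simp: max_partitions_def g_def partition_on_def)
    \<comment> \<open>Induction over finite subfamilies. All partial intersections contain the
      nonempty set \<open>C\<close>, so each uncrossing step meets overlapping sets.\<close>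
    have tight: "(\<Inter>P\<in>F. c P) \<subseteq> V \<and> sum r (\<Inter>P\<in>F. c P) = g (\<Inter>P\<in>F. c P)"
      if "finite F" "F \<noteq> {}" "F \<subseteq> max_partitions H V" for F
      using that
    proof (induction rule: finite_ne_induct)
      case (singleton P)
      then show ?case using c_tight[of P] by simp
    next
      case (insert P F)
      have sub: "C \<subseteq> c P" "C \<subseteq> (\<Inter>P\<in>F. c P)" using C insert.prems by auto
      have "c P \<inter> (\<Inter>P\<in>F. c P) \<noteq> {}" using sub \<open>C \<noteq> {}\<close> by blast
      moreover have "c P \<subseteq> V" "sum r (c P) = g (c P)" using c_tight insert.prems by auto
      moreover have "(\<Inter>P\<in>F. c P) \<subseteq> V" "sum r (\<Inter>P\<in>F. c P) = g (\<Inter>P\<in>F. c P)"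
        using insert by auto
      ultimately have "sum r (c P \<inter> (\<Inter>P\<in>F. c P)) = g (c P \<inter> (\<Inter>P\<in>F. c P))"
        using r_le submodular[of "c P" "\<Inter>P\<in>F. c P"]
        by (intro tight_Un_Int(2)[OF finite_V]) (auto simp: g_def)
      then show ?case using \<open>c P \<subseteq> V\<close> by auto
    qed
    have "finite (max_partitions H V)"
      using finite_nontrivial_partitions by (rule rev_finite_subset) (auto simp: max_partitions_def)
    then show ?thesis using tight[of "max_partitions H V"] max_partitions_nonempty C by auto
  qed
  then show ?thesis using max_partition_iff_tight[OF r nt] by (simp add: g_def)
qed

text \<open>Justifies the definite description: the common refinement of all maximisers is itself a
  maximiser, and antisymmetry of refinement makes the finest one unique.\<close>

lemma fundamental_partition_in_max_partitions: "fundamental_partition H V \<in> max_partitions H V"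
proof -
  let ?R = "common_refinement (max_partitions H V)"
  have R: "?R \<in> max_partitions H V" "\<forall>Q\<in>max_partitions H V. refines V ?R Q"
    using common_refinement_max_partition refines_common_refinement[of "max_partitions H V" V]
    by (auto simp: max_partitions_def nontrivial_partitions_def)
  have "fundamental_partition H V = ?R"
    unfolding fundamental_partition_def
  proof (rule the_equality)
    show "P = ?R" if "P \<in> max_partitions H V \<and> (\<forall>Q\<in>max_partitions H V. refines V P Q)" for P
      using that R refines_asym[of V P ?R] by blast
  qed (use R in blast)
  with R show ?thesis by simp
qed

section \<open>The fractional and the integral optimal rate vector\<close>

lemma packet_splitting_optimal:
  "\<exists>r\<in>R_ACO_opt H V. r \<in> V \<rightarrow>\<^sub>E \<rat> \<and>
     implementable_by_packet_splitting (card (fundamental_partition H V) - 1) V r"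
proof -
  let ?P = "fundamental_partition H V"
  note P = fundamental_partition_in_max_partitions
  have k: "card ?P - 1 > 0" using P by (auto simp: max_partitions_def nontrivial_partitions_def)
  obtain r where r: "r \<in> R_CO H V" "sum r V = partition_value H V ?P"
    and int: "\<And>i. i \<in> V \<Longrightarrow> real (card ?P - 1) * r i \<in> \<int>"
    using max_partition_rate_vector[OF P] by blast
  have "r i \<in> \<rat>" if "i \<in> V" for i
  proof -
    have "real (card ?P - 1) * r i / real (card ?P - 1) \<in> \<rat>"
      using int[OF that] Ints_subset_Rats by (intro Rats_divide) auto
    then show ?thesis using k by simp
  qed
  then have "r \<in> V \<rightarrow>\<^sub>E \<rat>" using r(1) by (auto simp: R_CO_def PiE_iff)
  then show ?thesis
    using r int k rate_ACO_eq[OF P] by (auto simp: R_ACO_opt_def implementable_by_packet_splitting_def)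
qed

text \<open>The rounded-up rate still dominates all partition values and is an integer, so
  \<open>ex_rate_vector\<close> applies with \<open>k = 1\<close>. Conversely, an integral rate
  vector has an integral total that is at least \<open>rate_ACO H V\<close>.\<close>

lemma integral_optimal:
  "R_NCO_opt H V \<noteq> {} \<and> rate_NCO H V = of_int \<lceil>rate_ACO H V\<rceil>"
proof -
  let ?t = "real_of_int \<lceil>rate_ACO H V\<rceil>"
  obtain P where P: "P \<in> max_partitions H V" using max_partitions_nonempty by auto
  have "partition_value H V Q \<le> ?t" if "Q \<in> nontrivial_partitions V" for Q
  proof -
    have "partition_value H V Q \<le> rate_ACO H V"
      using P that rate_ACO_eq[OF P] by (auto simp: max_partitions_def)
    then show ?thesis using le_of_int_ceiling order_trans by blast
  qed
  then obtain r where r: "r \<in> R_CO H V" "sum r V = ?t" "\<And>i. i \<in> V \<Longrightarrow> r i \<in> \<int>"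
    using ex_rate_vector[of 1 ?t] by auto
  have r_Ints: "r \<in> V \<rightarrow>\<^sub>E \<int>" using r by (auto simp: R_CO_def PiE_iff)
  have NCO: "rate_NCO H V = ?t"
    unfolding rate_NCO_def
  proof (rule Least_equality)
    show "?t \<in> (\<lambda>r. sum r V) ` (R_CO H V \<inter> (V \<rightarrow>\<^sub>E \<int>))"
      using r r_Ints by (auto intro!: rev_image_eqI[of r])
    fix u assume "u \<in> (\<lambda>r. sum r V) ` (R_CO H V \<inter> (V \<rightarrow>\<^sub>E \<int>))"
    then obtain s where s: "s \<in> R_CO H V" "s \<in> V \<rightarrow>\<^sub>E \<int>" "u = sum s V" by auto
    have "u \<in> \<int>" unfolding s(3) using s(2) by (intro Ints_sum) auto
    moreover have "rate_ACO H V \<le> u"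
      using partition_value_le_sum[OF s(1), of P] P rate_ACO_eq[OF P] s(3) by (auto simp: max_partitions_def)
    ultimately show "?t \<le> u" by (auto elim!: Ints_cases simp: ceiling_le_iff)
  qed
  moreover have "r \<in> R_NCO_opt H V" using r r_Ints NCO by (simp add: R_NCO_opt_def)
  ultimately show ?thesis by auto
qed

end

subsection \<open>Entropy of a linear source\<close>

lemma finite_carrier_vec: "finite (carrier_vec l :: 'f::finite vec set)"
proof -
  have "(carrier_vec l :: 'f vec set) \<subseteq> vec l ` ({..<l} \<rightarrow>\<^sub>E UNIV)"
  proof
    fix v :: "'f vec" assume "v \<in> carrier_vec l"
    then have eq: "v = vec l (\<lambda>i\<in>{..<l}. v $ i)" by (intro eq_vecI) auto
    show "v \<in> vec l ` ({..<l} \<rightarrow>\<^sub>E UNIV)" by (subst eq) (rule imageI, simp add: PiE_def extensional_def)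
  qed
  then show ?thesis by (rule finite_subset) (intro finite_imageI finite_PiE, auto)
qed

definition linear_subspace :: "nat \<Rightarrow> 'f::field vec set \<Rightarrow> bool" where
  "linear_subspace l S \<longleftrightarrow> S \<subseteq> carrier_vec l \<and> 0\<^sub>v l \<in> S \<and>
     (\<forall>a. \<forall>u\<in>S. \<forall>v\<in>S. a \<cdot>\<^sub>v u + v \<in> S)"

lemma linear_subspace_carrier: "linear_subspace l S \<Longrightarrow> u \<in> S \<Longrightarrow> u \<in> carrier_vec l"
  by (auto simp: linear_subspace_def)

lemma linear_subspace_comb: "linear_subspace l S \<Longrightarrow> u \<in> S \<Longrightarrow> v \<in> S \<Longrightarrow> a \<cdot>\<^sub>v u + v \<in> S"
  by (simp add: linear_subspace_def)

lemma linear_subspace_minus: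
  assumes "linear_subspace l S" "u \<in> S" "v \<in> S"
  shows "u - v \<in> S"
proof -
  have "u - v = (- 1) \<cdot>\<^sub>v v + u"
    using linear_subspace_carrier[OF assms(1,2)] linear_subspace_carrier[OF assms(1,3)] by (intro eq_vecI) auto
  then show ?thesis using linear_subspace_comb assms by metis
qed

text \<open>The exponent is the dimension. Induction on the cardinality splits off one line at a
  time, and each line contributes a factor \<open>CARD('f)\<close>. The integrality of the entropy
  rests on this.\<close>

lemma card_linear_subspace:
  fixes S :: "'f::{field,finite} vec set"
  assumes "linear_subspace l S"
  shows "\<exists>k. card S = CARD('f) ^ k"
  using assms
proof (induction "card S" arbitrary: S rule: less_induct)
  case less
  have S: "S \<subseteq> carrier_vec l" "0\<^sub>v l \<in> S" using less.prems by (auto simp: linear_subspace_def)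
  have fin: "finite S" using S(1) finite_carrier_vec by (rule finite_subset)
  show ?case
  proof (cases "S = {0\<^sub>v l}")
    case True
    then have "card S = CARD('f) ^ 0" by simp
    then show ?thesis by blast
  next
    case False
    then obtain v where v: "v \<in> S" "v \<noteq> 0\<^sub>v l" using S by blast
    then have v_dim: "dim_vec v = l" using S by auto
    obtain i where i: "i < l" "v $ i \<noteq> 0"
    proof (rule ccontr)
      assume "\<not> thesis"
      then have "v = 0\<^sub>v l" using v_dim that by (intro eq_vecI) auto
      with v show False by simp
    qed
    \<comment> \<open>Normalised so that coordinate \<open>i\<close> equals 1; the coefficient of
      \<open>w\<close> in a decomposition can then be read off from coordinate
      \<open>i\<close>.\<close>
    define w where "w = inverse (v $ i) \<cdot>\<^sub>v v"
    have "w = inverse (v $ i) \<cdot>\<^sub>v v + 0\<^sub>v l" using v_dim by (intro eq_vecI) (auto simp: w_def)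
    then have w: "w \<in> S" using linear_subspace_comb[OF less.prems v(1) S(2)] by simp
    have w_i: "w $ i = 1" and w_dim: "dim_vec w = l" using i v_dim by (simp_all add: w_def)
    \<comment> \<open>\<open>S\<close> is the direct sum of the line through \<open>w\<close> and the hyperplane section \<open>s $ i = 0\<close>.\<close>
    define S' where "S' = {s \<in> S. s $ i = 0}"
    have S': "linear_subspace l S'"
      unfolding linear_subspace_def
    proof (intro conjI ballI allI)
      show "S' \<subseteq> carrier_vec l" "0\<^sub>v l \<in> S'" using S i(1) by (auto simp: S'_def)
      fix a u v assume uv: "u \<in> S'" "v \<in> S'"
      then have "a \<cdot>\<^sub>v u + v \<in> S" "dim_vec u = l" "dim_vec v = l"
        using S(1) linear_subspace_comb[OF less.prems] by (auto simp: S'_def)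
      then show "a \<cdot>\<^sub>v u + v \<in> S'" using uv i(1) by (simp add: S'_def)
    qed
    have "S' \<subset> S" using v i by (auto simp: S'_def)
    then have "card S' < card S" using fin by (intro psubset_card_mono)
    then obtain k where k: "card S' = CARD('f) ^ k" using less.hyps S' by blast
    have "bij_betw (\<lambda>(c, s). c \<cdot>\<^sub>v w + s) (UNIV \<times> S') S"
      unfolding bij_betw_def
    proof (intro conjI subset_antisym subsetI)
      show "inj_on (\<lambda>(c, s). c \<cdot>\<^sub>v w + s) (UNIV \<times> S')"
      proof (rule inj_onI, clarsimp)
        fix c s d t assume s: "s \<in> S'" and t: "t \<in> S'" and eq: "c \<cdot>\<^sub>v w + s = d \<cdot>\<^sub>v w + t"
        have dim: "dim_vec s = l" "dim_vec t = l" using s t S by (auto simp: S'_def)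
        have "(c \<cdot>\<^sub>v w + s) $ i = c" "(d \<cdot>\<^sub>v w + t) $ i = d"
          using s t i dim w_i w_dim by (auto simp: S'_def)
        then have "c = d" using eq by simp
        moreover have "s = t"
        proof (rule eq_vecI)
          fix j assume "j < dim_vec t"
          then have "(c \<cdot>\<^sub>v w + s) $ j = c * w $ j + s $ j" "(d \<cdot>\<^sub>v w + t) $ j = d * w $ j + t $ j"
            using dim w_dim by auto
          then show "s $ j = t $ j" using eq \<open>c = d\<close> by simp
        qed (simp add: dim)
        ultimately show "c = d \<and> s = t" ..
      qed
      show "u \<in> S" if "u \<in> (\<lambda>(c, s). c \<cdot>\<^sub>v w + s) ` (UNIV \<times> S')" for u
        using that linear_subspace_comb[OF less.prems w] by (auto simp: S'_def)
      show "u \<in> (\<lambda>(c, s). c \<cdot>\<^sub>v w + s) ` (UNIV \<times> S')" if u: "u \<in> S" for u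
      proof (rule image_eqI)
        have u_dim: "dim_vec u = l" using u S by auto
        \<comment> \<open>Removing the multiple \<open>u $ i\<close> of \<open>w\<close> makes
          coordinate \<open>i\<close> vanish.\<close>
        have "(- (u $ i)) \<cdot>\<^sub>v w + u \<in> S" by (rule linear_subspace_comb[OF less.prems w u])
        then show "(u $ i, (- (u $ i)) \<cdot>\<^sub>v w + u) \<in> UNIV \<times> S'"
          using i u_dim w_dim w_i by (auto simp: S'_def)
        show "u = (case (u $ i, (- (u $ i)) \<cdot>\<^sub>v w + u) of (c, s) \<Rightarrow> c \<cdot>\<^sub>v w + s)"
          using u_dim w_dim by (intro eq_vecI) auto
      qed
    qed
    then have "card S = card ((UNIV :: 'f set) \<times> S')" by (simp add: bij_betw_same_card)
    also have "\<dots> = CARD('f) ^ Suc k" by (simp add: card_cartesian_product k)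
    finally show ?thesis by blast
  qed
qed

text \<open>Counting form of the dimension formula for \<open>S + T\<close>, where \<open>U\<close>
  may be any finite set containing all sums. It is proved by injecting \<open>S \<times> T\<close>
  into \<open>(S \<inter> T) \<times> U\<close>.\<close>

lemma card_linear_subspace_Int:
  fixes S T U :: "'f::{field,finite} vec set"
  assumes S: "linear_subspace l S" and T: "linear_subspace l T"
    and U: "finite U" "\<And>s t. s \<in> S \<Longrightarrow> t \<in> T \<Longrightarrow> s + t \<in> U"
  shows "card S * card T \<le> card (S \<inter> T) * card U"
proof -
  obtain p where p: "\<And>s t. s \<in> S \<Longrightarrow> t \<in> T \<Longrightarrow> p (s + t) \<in> S \<times> T \<and> fst (p (s + t)) + snd (p (s + t)) = s + t"
  proof -
    assume *: "\<And>p. (\<And>s t. s \<in> S \<Longrightarrow> t \<in> T \<Longrightarrow> p (s + t) \<in> S \<times> T \<and> fst (p (s + t)) + snd (p (s + t)) = s + t) \<Longrightarrow> thesis"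
    show thesis
      by (rule *[of "\<lambda>u. SOME p. p \<in> S \<times> T \<and> fst p + snd p = u"], rule someI2_ex) auto
  qed
  \<comment> \<open>\<open>p u\<close> is a chosen decomposition of \<open>u\<close>; two decompositions differ by an element of \<open>S \<inter> T\<close>.\<close>
  let ?g = "\<lambda>(s, t). (s - fst (p (s + t)), s + t)"
  have "inj_on ?g (S \<times> T)"
  proof (rule inj_onI)
    fix a b assume ab: "a \<in> S \<times> T" "b \<in> S \<times> T" "?g a = ?g b"
    obtain s t s' t' where a: "a = (s, t)" and b: "b = (s', t')" by (metis surj_pair)
    have st: "s \<in> S" "t \<in> T" "s' \<in> S" "t' \<in> T"
      and eq: "s - fst (p (s + t)) = s' - fst (p (s' + t'))" "s + t = s' + t'"
      using ab by (auto simp: a b)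
    have dim: "dim_vec s = l" "dim_vec s' = l" "dim_vec t = l" "dim_vec t' = l" "dim_vec (fst (p (s' + t'))) = l"
      using st p[OF st(3,4)] linear_subspace_carrier[OF S] linear_subspace_carrier[OF T]
      by (auto simp: mem_Times_iff)
    \<comment> \<open>Equal sums have the same chosen decomposition, so equal differences force
      equal \<open>s\<close>, and then equal \<open>t\<close>.\<close>
    have eq': "s - fst (p (s' + t')) = s' - fst (p (s' + t'))" using eq by simp
    have s: "s $ j = s' $ j" if "j < l" for j
      using arg_cong[OF eq', of "\<lambda>v. v $ j"] that dim by simp
    have "t $ j = t' $ j" if "j < l" for j
      using arg_cong[OF eq(2), of "\<lambda>v. v $ j"] that dim s by simp
    with s show "a = b" using dim by (auto simp: a b intro!: eq_vecI)
  qed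
  moreover have "?g ` (S \<times> T) \<subseteq> (S \<inter> T) \<times> U"
  proof clarify
    fix s t assume st: "s \<in> S" "t \<in> T"
    have pp: "fst (p (s + t)) \<in> S" "snd (p (s + t)) \<in> T" "fst (p (s + t)) + snd (p (s + t)) = s + t"
      using p[OF st] by (auto simp: mem_Times_iff)
    have dim: "dim_vec s = l" "dim_vec t = l" "dim_vec (fst (p (s + t))) = l" "dim_vec (snd (p (s + t))) = l"
      using st pp linear_subspace_carrier[OF S] linear_subspace_carrier[OF T] by auto
    \<comment> \<open>The left side lies in \<open>S\<close> and the right side in \<open>T\<close>,
      so the difference lies in both.\<close>
    have "s - fst (p (s + t)) = snd (p (s + t)) - t"
    proof (rule eq_vecI)
      fix j assume "j < dim_vec (snd (p (s + t)) - t)"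
      then show "(s - fst (p (s + t))) $ j = (snd (p (s + t)) - t) $ j"
        using arg_cong[OF pp(3), of "\<lambda>v. v $ j"] dim by (simp add: algebra_simps)
    qed (simp add: dim)
    then show "s - fst (p (s + t)) \<in> S \<inter> T \<and> s + t \<in> U"
      using linear_subspace_minus[OF S st(1) pp(1)] linear_subspace_minus[OF T pp(2) st(2)] U(2)[OF st] by auto
  qed
  moreover have "finite (S \<inter> T)"
    using S finite_carrier_vec by (auto simp: linear_subspace_def intro: finite_subset)
  ultimately have "card (S \<times> T) \<le> card ((S \<inter> T) \<times> U)"
    using U(1) by (intro card_inj_on_le[of ?g]) auto
  then show ?thesis by (simp add: card_cartesian_product)
qed

section \<open>Kernels of stacked matrices\<close>

text \<open>The kernel of the matrix obtained by stacking the \<open>A i\<close> for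
  \<open>i \<in> X\<close>; its codimension is the rank of that matrix.\<close>

definition common_kernel :: "nat \<Rightarrow> ('v \<Rightarrow> 'f::field mat) \<Rightarrow> 'v set \<Rightarrow> 'f vec set" where
  "common_kernel l A X = {u \<in> carrier_vec l. \<forall>i\<in>X. A i *\<^sub>v u = 0\<^sub>v (dim_row (A i))}"

lemma linear_subspace_common_kernel:
  assumes "\<And>i. i \<in> X \<Longrightarrow> dim_col (A i) = l"
  shows "linear_subspace l (common_kernel l A X)"
proof -
  have A: "A i \<in> carrier_mat (dim_row (A i)) l" if "i \<in> X" for i using assms[OF that] by auto
  have "A i *\<^sub>v (c \<cdot>\<^sub>v u + v) = 0\<^sub>v (dim_row (A i))"
    if "i \<in> X" "u \<in> carrier_vec l" "v \<in> carrier_vec l"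
      "A i *\<^sub>v u = 0\<^sub>v (dim_row (A i))" "A i *\<^sub>v v = 0\<^sub>v (dim_row (A i))" for i c u v
  proof -
    have "A i *\<^sub>v (c \<cdot>\<^sub>v u + v) = c \<cdot>\<^sub>v (A i *\<^sub>v u) + A i *\<^sub>v v"
      using mult_add_distrib_mat_vec[OF A[OF that(1)], of "c \<cdot>\<^sub>v u" v]
        mult_mat_vec[OF A[OF that(1)] that(2), of c] that(2,3) by simp
    then show ?thesis unfolding that(4,5) by (auto intro: eq_vecI)
  qed
  moreover have "A i *\<^sub>v 0\<^sub>v l = 0\<^sub>v (dim_row (A i))" if "i \<in> X" for i
    by (intro eq_vecI) (simp_all add: scalar_prod_def)
  ultimately show ?thesis
    by (auto simp: linear_subspace_def common_kernel_def)
qed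

text \<open>The fibre through \<open>u\<close> is the coset \<open>u\<close> plus the common kernel;
  translation by \<open>u\<close> is the bijection.\<close>

lemma card_fibre:
  fixes A :: "'v \<Rightarrow> 'f::field mat"
  assumes A: "\<And>i. i \<in> X \<Longrightarrow> dim_col (A i) = l" and u: "u \<in> carrier_vec l"
  shows "card {v \<in> carrier_vec l. \<forall>i\<in>X. A i *\<^sub>v v = A i *\<^sub>v u} = card (common_kernel l A X)" (is "card ?F = _")
proof -
  have Ac: "A i \<in> carrier_mat (dim_row (A i)) l" if "i \<in> X" for i using A[OF that] by auto
  have "bij_betw (\<lambda>v. v - u) ?F (common_kernel l A X)"
  proof (rule bij_betw_byWitness[where f' = "\<lambda>v. v + u"])
    show "\<forall>v\<in>?F. v - u + u = v" using u by (auto intro!: eq_vecI)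
    show "\<forall>v\<in>common_kernel l A X. v + u - u = v" using u by (auto simp: common_kernel_def intro!: eq_vecI)
    show "(\<lambda>v. v - u) ` ?F \<subseteq> common_kernel l A X"
      using u by (auto simp: common_kernel_def mult_minus_distrib_mat_vec[OF Ac])
    show "(\<lambda>v. v + u) ` common_kernel l A X \<subseteq> ?F"
      using u by (auto simp: common_kernel_def mult_add_distrib_mat_vec[OF Ac])
  qed
  then show ?thesis by (rule bij_betw_same_card)
qed

lemma card_field_gt_1: "1 < CARD('f::{field,finite})"
proof -
  have "card {0, 1 :: 'f} \<le> CARD('f)" by (intro card_mono) auto
  then show ?thesis by simp
qed

text \<open>All fibres of the stacked linear map have the size of its kernel and \<open>x\<close> is
  uniform, so the joint variable is uniform on its values with probability \<open>p\<close>, and its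
  entropy is the logarithm of \<open>1 / p\<close>.\<close>

lemma source_entropy_linear:
  fixes Z :: "'v \<Rightarrow> 'w \<Rightarrow> 'f::{field,finite} vec"
  assumes "prob_space M"
    and x: "x \<in> M \<rightarrow>\<^sub>M count_space (carrier_vec l)"
    and unif: "distr M (count_space (carrier_vec l)) x = uniform_count_measure (carrier_vec l)"
    and A: "\<And>i. i \<in> X \<Longrightarrow> dim_col (A i) = l"
    and Z: "\<And>i \<omega>. i \<in> X \<Longrightarrow> \<omega> \<in> space M \<Longrightarrow> Z i \<omega> = A i *\<^sub>v x \<omega>"
  shows "source_entropy M Z X = log (CARD('f))
    (real (card (carrier_vec l :: 'f vec set)) / real (card (common_kernel l A X)))"
proof -
  have "1 < real CARD('f)" using card_field_gt_1[where 'f = 'f] by simp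
  then interpret information_space M "CARD('f)"
    using \<open>prob_space M\<close> by (intro information_space.intro information_space_axioms.intro)
  let ?C = "carrier_vec l :: 'f vec set"
  define Y where "Y = (\<lambda>\<omega>. \<lambda>i\<in>X. Z i \<omega>)"
  define p where "p = real (card (common_kernel l A X)) / real (card ?C)"
  have x_C: "x \<omega> \<in> ?C" if "\<omega> \<in> space M" for \<omega>
    using measurable_space[OF x that] by simp
  \<comment> \<open>The event that the joint variable takes a given value is the event that
    \<open>x\<close> lies in one fibre of the stacked map.\<close>
  have vim: "Y -` {Y \<omega>} \<inter> space M = x -` {v \<in> ?C. \<forall>i\<in>X. A i *\<^sub>v v = A i *\<^sub>v x \<omega>} \<inter> space M"
    if "\<omega> \<in> space M" for \<omega>
  proof -
    have "Y \<omega>' = Y \<omega> \<longleftrightarrow> (\<forall>i\<in>X. Z i \<omega>' = Z i \<omega>)" for \<omega>'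
    proof
      assume eq: "Y \<omega>' = Y \<omega>"
      show "\<forall>i\<in>X. Z i \<omega>' = Z i \<omega>"
      proof
        fix i assume "i \<in> X"
        then show "Z i \<omega>' = Z i \<omega>" using fun_cong[OF eq, of i] by (simp add: Y_def)
      qed
    qed (auto simp: Y_def intro!: restrict_ext)
    then have "Y \<omega>' = Y \<omega> \<longleftrightarrow> x \<omega>' \<in> {v \<in> ?C. \<forall>i\<in>X. A i *\<^sub>v v = A i *\<^sub>v x \<omega>}"
      if "\<omega>' \<in> space M" for \<omega>'
      using Z[OF _ that] Z[OF _ \<open>\<omega> \<in> space M\<close>] x_C[OF that] by simp
    then show ?thesis by blast
  qed
  have prob_Y: "measure M (Y -` {Y \<omega>} \<inter> space M) = p" if "\<omega> \<in> space M" for \<omega>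
  proof -
    let ?F = "{v \<in> ?C. \<forall>i\<in>X. A i *\<^sub>v v = A i *\<^sub>v x \<omega>}"
    have "measure M (Y -` {Y \<omega>} \<inter> space M) = measure (distr M (count_space ?C) x) ?F"
      unfolding vim[OF that] using x by (subst measure_distr) auto
    also have "\<dots> = card ?F / card ?C"
      unfolding unif by (intro measure_uniform_count_measure finite_carrier_vec) auto
    also have "card ?F = card (common_kernel l A X)"
      using A x_C[OF that] by (rule card_fibre)
    finally show ?thesis by (simp add: p_def)
  qed
  have "simple_function M Y"
    unfolding simple_function_def
  proof
    have "Y ` space M \<subseteq> (\<lambda>v. \<lambda>i\<in>X. A i *\<^sub>v v) ` ?C"
      using Z x_C by (auto simp: Y_def intro!: rev_image_eqI[of "x _"])
    then show "finite (Y ` space M)" using finite_carrier_vec finite_surj by blast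
    show "\<forall>y\<in>Y ` space M. Y -` {y} \<inter> space M \<in> sets M"
    proof clarify
      fix \<omega> assume \<omega>: "\<omega> \<in> space M"
      show "Y -` {Y \<omega>} \<inter> space M \<in> sets M"
        unfolding vim[OF \<omega>] by (rule measurable_sets[OF x]) auto
    qed
  qed
  then have sd: "simple_distributed M Y (\<lambda>_. p)"
    using prob_Y by (intro simple_distributedI) (auto simp: p_def)
  have "source_entropy M Z X = - (\<Sum>y\<in>Y ` space M. p * log (CARD('f)) p)"
    using entropy_simple_distributed[OF sd] by (simp add: source_entropy_def Y_def)
  also have "\<dots> = - (\<Sum>y\<in>Y ` space M. p) * log (CARD('f)) p"
    by (simp add: mult.assoc)
  \<comment> \<open>The constant probabilities \<open>p\<close> sum to 1 over the range of
    \<open>Y\<close>.\<close>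
  also have "\<dots> = - log (CARD('f)) p"
    using simple_distributed_sum_space[OF sd] by simp
  also have "\<dots> = log (CARD('f)) (inverse p)"
    by (simp only: log_inverse)
  finally show ?thesis by (simp add: p_def)
qed

lemma log_card_linear_subspace:
  assumes "linear_subspace l (S :: 'f::{field,finite} vec set)"
  shows "card S > 0" "log (CARD('f)) (card S) \<in> \<int>"
proof -
  obtain k where k: "card S = CARD('f) ^ k" using card_linear_subspace[OF assms] by blast
  then show "card S > 0" by simp
  have "log (CARD('f)) (card S) = real k"
    using log_of_power_eq[of "card S" "CARD('f)" k] k card_field_gt_1[where 'f = 'f] by simp
  then show "log (CARD('f)) (card S) \<in> \<int>" by simp
qed

text \<open>Entropy is the codimension of the common kernel \<open>?K X\<close>. Since
  \<open>?K (X \<union> Y)\<close> is the intersection of \<open>?K X\<close> and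
  \<open>?K Y\<close>, and \<open>?K (X \<inter> Y)\<close> contains their sum, the dimension
  formula becomes submodularity after taking logarithms.\<close>

lemma integral_submodular_source_entropy:
  fixes Z :: "'v \<Rightarrow> 'w \<Rightarrow> 'f::{field,finite} vec"
  assumes "finite V" "card V > 1" and source: "finite_linear_source M V Z"
  shows "integral_submodular V (source_entropy M Z)"
proof -
  obtain l x A where M: "prob_space M"
    and x: "x \<in> M \<rightarrow>\<^sub>M count_space (carrier_vec l)"
      "distr M (count_space (carrier_vec l)) x = uniform_count_measure (carrier_vec l)"
    and A: "\<And>i. i \<in> V \<Longrightarrow> dim_col (A i) = l"
    and Z: "\<And>i \<omega>. i \<in> V \<Longrightarrow> \<omega> \<in> space M \<Longrightarrow> Z i \<omega> = A i *\<^sub>v x \<omega>"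
    using source unfolding finite_linear_source_def by blast
  let ?q = "real CARD('f)" and ?C = "carrier_vec l :: 'f vec set"
  let ?K = "common_kernel l A"
  have q: "?q > 1" using card_field_gt_1[where 'f = 'f] by simp
  have K: "linear_subspace l (?K X)" if "X \<subseteq> V" for X
    using that A by (intro linear_subspace_common_kernel) auto
  have C: "linear_subspace l ?C" by (auto simp: linear_subspace_def)
  note pos = log_card_linear_subspace(1) and int = log_card_linear_subspace(2)
  have H: "source_entropy M Z X = log ?q (card ?C) - log ?q (card (?K X))" if "X \<subseteq> V" for X
  proof -
    have "source_entropy M Z X = log ?q (real (card ?C) / real (card (?K X)))"
      using A Z that by (intro source_entropy_linear[OF M x]) auto
    then show ?thesis using pos[OF K[OF that]] pos[OF C] q by (simp add: log_divide)
  qed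
  show ?thesis
  proof
    show "source_entropy M Z X \<in> \<int>" if "X \<subseteq> V" for X
      unfolding H[OF that] using int[OF C] int[OF K[OF that]] by simp
    show "source_entropy M Z (X \<union> Y) + source_entropy M Z (X \<inter> Y)
        \<le> source_entropy M Z X + source_entropy M Z Y" if XY: "X \<subseteq> V" "Y \<subseteq> V" for X Y
    proof -
      have sub: "X \<union> Y \<subseteq> V" "X \<inter> Y \<subseteq> V" using XY by auto
      have Int: "?K X \<inter> ?K Y = ?K (X \<union> Y)" by (auto simp: common_kernel_def)
      have add: "s + t \<in> ?K (X \<inter> Y)" if "s \<in> ?K X" "t \<in> ?K Y" for s t
      proof -
        have "s \<in> ?K (X \<inter> Y)" "t \<in> ?K (X \<inter> Y)" using that by (auto simp: common_kernel_def)
        then show ?thesis using linear_subspace_comb[OF K[OF sub(2)], of s t 1] by simp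
      qed
      have "finite (?K (X \<inter> Y))"
        using finite_carrier_vec[of l] by (rule rev_finite_subset) (auto simp: common_kernel_def)
      then have "card (?K X) * card (?K Y) \<le> card (?K (X \<union> Y)) * card (?K (X \<inter> Y))"
        using card_linear_subspace_Int[OF K[OF XY(1)] K[OF XY(2)] _ add] unfolding Int by blast
      then have "real (card (?K X)) * card (?K Y) \<le> real (card (?K (X \<union> Y))) * card (?K (X \<inter> Y))"
        by (simp only: of_nat_mult[symmetric] of_nat_le_iff)
      moreover have "0 < real (card (?K X))" "0 < real (card (?K Y))"
        "0 < real (card (?K (X \<union> Y)))" "0 < real (card (?K (X \<inter> Y)))"
        using pos[OF K] XY sub by auto
      ultimately have "log ?q (card (?K X)) + log ?q (card (?K Y))
          \<le> log ?q (card (?K (X \<union> Y))) + log ?q (card (?K (X \<inter> Y)))"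
        using log_mono[OF q, of "real (card (?K X)) * card (?K Y)"
            "real (card (?K (X \<union> Y))) * card (?K (X \<inter> Y))"]
        by (simp add: log_mult_pos)
      then show ?thesis using XY sub by (simp add: H)
    qed
  qed (use assms in auto)
qed

theorem mainTheorem3:
  fixes M :: "'w measure"
    and V :: "'v set"
    and Z :: "'v \<Rightarrow> 'w \<Rightarrow> 'f::{field,finite} vec"
    and H :: "'v set \<Rightarrow> real"
  defines "H \<equiv> source_entropy M Z"
  assumes "finite V"
    and "card V > 1"
    and "finite_linear_source M V Z"
  shows "(R_NCO_opt H V \<noteq> {} \<and> rate_NCO H V = of_int \<lceil>rate_ACO H V\<rceil>) \<and>
         (\<exists>r \<in> R_ACO_opt H V. r \<in> V \<rightarrow>\<^sub>E \<rat> \<and>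
            implementable_by_packet_splitting (card (fundamental_partition H V) - 1) V r)"
proof -
  interpret integral_submodular V H
    unfolding H_def using assms(2-4) by (rule integral_submodular_source_entropy)
  show ?thesis using integral_optimal packet_splitting_optimal by blast
qed

end
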